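(* There is an absolute constant $c>1/2$ such that for every integer $N\ge 2$ there exists a class $\mathcal{F}_N$ of $\{1,-1\}$-valued functions on some set such that $\mathsf{Edim}(\mathcal{F}_N)=N$ and $$\max\{\mathsf{Sdim}(\mathcal{F}_N),\mathsf{Tdim}(\mathcal{F}_N)\}\ <\ c\cdot\log_2 N.$$
   Context: For $\mathcal{F}\subseteq(\mathcal{X}\to\{1,-1\})$ and $f^\star\in\mathcal{F}$, each of the following is the largest $m$ such that there exist $(x_1,f_1),\dots,(x_m,f_m)\in\mathcal{X}\times\mathcal{F}$ satisfying the stated condition for all $i\in\{1,\dots,m\}$. - Combinatorial eluder dimension $\mathsf{Edim}_{f^\star}(\mathcal{F})$: $f_i(x_i)\ne f^\star(x_i)$, and $f_i(x_j)=f^\star(x_j)$ for all $j<i$. - Star number $\mathsf{Sdim}_{f^\star}(\mathcal{F})$: $f_i(x_i)\ne f^\star(x_i)$, and $f_i(x_j)=f^\star(x_j)$ for all $j\ne i$. - Threshold dimension $\mathsf{Tdim}_{f^\star}(\mathcal{F})$: $f_i(x_k)\ne f^\star(x_k)$ for all $k\ge i$, and $f_i(x_j)=f^\star(x_j)$ for all $j<i$. Moreover $\mathsf{Edim}(\mathcal{F})=\sup_{f\in\mathcal{F}}\mathsf{Edim}_f(\mathcal{F})$, and similarly for $\mathsf{Sdim}(\mathcal{F})$ and $\mathsf{Tdim}(\mathcal{F})$. *)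

theory Defs
  imports Complex_Main "HOL-Library.FuncSet" "HOL-Library.Extended_Nat" "HOL-Library.Extended_Real"
begin

(* The domain is an explicit carrier set X, and X \<rightarrow>\<^sub>E {1, -1} is the set of all sign-valued
   functions on X: extensionality makes two functions equal iff they agree on X. *)

definition sign_functions :: "'a set \<Rightarrow> ('a \<Rightarrow> int) set" where
  "sign_functions X = X \<rightarrow>\<^sub>E {1, -1}"

definition eluder_witness ::
  "'a set \<Rightarrow> ('a \<Rightarrow> int) set \<Rightarrow> ('a \<Rightarrow> int) \<Rightarrow> nat \<Rightarrow> (nat \<Rightarrow> 'a) \<Rightarrow> (nat \<Rightarrow> 'a \<Rightarrow> int) \<Rightarrow> bool" where
  "eluder_witness X F g m x f \<longleftrightarrow>
     (\<forall>i\<in>{1..m}. x i \<in> X \<and> f i \<in> F \<and>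
        f i (x i) \<noteq> g (x i) \<and>
        (\<forall>j\<in>{1..m}. j < i \<longrightarrow> f i (x j) = g (x j)))"

definition star_witness ::
  "'a set \<Rightarrow> ('a \<Rightarrow> int) set \<Rightarrow> ('a \<Rightarrow> int) \<Rightarrow> nat \<Rightarrow> (nat \<Rightarrow> 'a) \<Rightarrow> (nat \<Rightarrow> 'a \<Rightarrow> int) \<Rightarrow> bool" where
  "star_witness X F g m x f \<longleftrightarrow>
     (\<forall>i\<in>{1..m}. x i \<in> X \<and> f i \<in> F \<and>
        f i (x i) \<noteq> g (x i) \<and>
        (\<forall>j\<in>{1..m}. j \<noteq> i \<longrightarrow> f i (x j) = g (x j)))"

definition threshold_witness ::
  "'a set \<Rightarrow> ('a \<Rightarrow> int) set \<Rightarrow> ('a \<Rightarrow> int) \<Rightarrow> nat \<Rightarrow> (nat \<Rightarrow> 'a) \<Rightarrow> (nat \<Rightarrow> 'a \<Rightarrow> int) \<Rightarrow> bool" where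
  "threshold_witness X F g m x f \<longleftrightarrow>
     (\<forall>i\<in>{1..m}. x i \<in> X \<and> f i \<in> F \<and>
        (\<forall>k\<in>{1..m}. k \<ge> i \<longrightarrow> f i (x k) \<noteq> g (x k)) \<and>
        (\<forall>j\<in>{1..m}. j < i \<longrightarrow> f i (x j) = g (x j)))"

(* In the dimensions below, m = 0 always qualifies and the admissible m are closed downwards,
   so the supremum in enat is the largest admissible m if there is one, and \<infinity> otherwise. *)

definition Edim_at :: "'a set \<Rightarrow> ('a \<Rightarrow> int) set \<Rightarrow> ('a \<Rightarrow> int) \<Rightarrow> enat" where
  "Edim_at X F g = (SUP m\<in>{m. \<exists>x f. eluder_witness X F g m x f}. enat m)"

definition Sdim_at :: "'a set \<Rightarrow> ('a \<Rightarrow> int) set \<Rightarrow> ('a \<Rightarrow> int) \<Rightarrow> enat" where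
  "Sdim_at X F g = (SUP m\<in>{m. \<exists>x f. star_witness X F g m x f}. enat m)"

definition Tdim_at :: "'a set \<Rightarrow> ('a \<Rightarrow> int) set \<Rightarrow> ('a \<Rightarrow> int) \<Rightarrow> enat" where
  "Tdim_at X F g = (SUP m\<in>{m. \<exists>x f. threshold_witness X F g m x f}. enat m)"

definition Edim :: "'a set \<Rightarrow> ('a \<Rightarrow> int) set \<Rightarrow> enat" where
  "Edim X F = (SUP g\<in>F. Edim_at X F g)"

definition Sdim :: "'a set \<Rightarrow> ('a \<Rightarrow> int) set \<Rightarrow> enat" where
  "Sdim X F = (SUP g\<in>F. Sdim_at X F g)"

definition Tdim :: "'a set \<Rightarrow> ('a \<Rightarrow> int) set \<Rightarrow> enat" where
  "Tdim X F = (SUP g\<in>F. Tdim_at X F g)"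

end

theory Submission imports Defs begin

text \<open>
  Take the constant function \<open>1\<close> on \<open>{..<N}\<close> together with the rows of a unitriangular sign matrix
  whose entries above the diagonal come from a random bit matrix. Unitriangularity gives
  eluder dimension \<open>N\<close>, while a star or threshold configuration of size \<open>4 * k + 4\<close>, around any
  base function, contains a constant \<open>k \<times> k\<close> rectangle strictly above the diagonal.
  By a union bound some bit matrix has no constant rectangle of size \<open>k = O(log N)\<close>.
\<close>

section \<open>Bit matrices without large constant rectangles\<close>

text \<open>A bipartite Ramsey property: \<open>E\<close> is the set of ones of a bit matrix, and
  neither \<open>E\<close> nor its complement contains a \<open>k \<times> k\<close> rectangle of
  rows and columns.\<close>

definition no_homogeneous :: "nat \<Rightarrow> nat \<Rightarrow> (nat \<times> nat) set \<Rightarrow> bool" where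
  "no_homogeneous N k E \<longleftrightarrow>
     (\<forall>R C. R \<subseteq> {..<N} \<longrightarrow> C \<subseteq> {..<N} \<longrightarrow> k \<le> card R \<longrightarrow> k \<le> card C \<longrightarrow>
        \<not> R \<times> C \<subseteq> E \<and> R \<times> C \<inter> E \<noteq> {})"

text \<open>The union bound as a count: there are at most \<open>N ^ (2 * k)\<close> rectangles, and
  each is constant for at most a share \<open>2 / 2 ^ (k * k)\<close> of all bit matrices.\<close>

lemma ex_no_homogeneous:
  assumes "2 * N ^ (2 * k) < 2 ^ (k * k)"
  shows "\<exists>E. no_homogeneous N k E"
proof -
  define S where "S = {..<N} \<times> {..<N}"
  define \<K> where "\<K> = {K. K \<subseteq> {..<N} \<and> card K = k}"
  \<comment> \<open>\<open>B (R, C)\<close> collects the bad matrices, all ones or all zeros on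
    \<open>R \<times> C\<close>.\<close>
  define B where
    "B = (\<lambda>(R, C). {E. R \<times> C \<subseteq> E \<and> E \<subseteq> S} \<union> Pow (S - R \<times> C))"
  have fS: "finite S" and cS: "card S = N * N"
    by (auto simp: S_def card_cartesian_product)
  have f\<K>: "finite \<K>" unfolding \<K>_def by simp
  have c\<K>: "card \<K> \<le> N ^ k"
    using n_subsets[of "{..<N}" k] binomial_le_pow[of k N]
    by (cases "k \<le> N") (simp_all only: \<K>_def binomial_eq_0 card_lessThan finite_lessThan not_le)
  have sub: "R \<times> C \<subseteq> S" and cRC: "card (R \<times> C) = k * k" if "R \<in> \<K>" "C \<in> \<K>" for R C
    using that by (auto simp: \<K>_def S_def card_cartesian_product)
  have cB: "card (B p) * 2 ^ (k * k) \<le> 2 * 2 ^ (N * N)" if "p \<in> \<K> \<times> \<K>" for p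
  proof -
    obtain R C where p: "p = (R, C)" "R \<in> \<K>" "C \<in> \<K>" using \<open>p \<in> \<K> \<times> \<K>\<close> by auto
    have fD: "finite (S - R \<times> C)" using fS by blast
    \<comment> \<open>A matrix that is all ones on the rectangle is determined by its entries
      outside it.\<close>
    have "{E. R \<times> C \<subseteq> E \<and> E \<subseteq> S} \<subseteq> (\<lambda>D. R \<times> C \<union> D) ` Pow (S - R \<times> C)"
    proof
      fix E assume E: "E \<in> {E. R \<times> C \<subseteq> E \<and> E \<subseteq> S}"
      then have "E = R \<times> C \<union> (E - R \<times> C)" by auto
      moreover have "E - R \<times> C \<in> Pow (S - R \<times> C)" using E by auto
      ultimately show "E \<in> (\<lambda>D. R \<times> C \<union> D) ` Pow (S - R \<times> C)" by (rule image_eqI)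
    qed
    then have "card {E. R \<times> C \<subseteq> E \<and> E \<subseteq> S} \<le> card (Pow (S - R \<times> C))"
      using fD by (meson finite_Pow_iff surj_card_le)
    then have "card (B p) \<le> 2 * card (Pow (S - R \<times> C))"
      using card_Un_le[of "{E. R \<times> C \<subseteq> E \<and> E \<subseteq> S}" "Pow (S - R \<times> C)"] by (simp add: B_def p)
    also have "card (Pow (S - R \<times> C)) = 2 ^ (N * N - k * k)"
      using sub[OF p(2,3)] cRC[OF p(2,3)] fS cS fD
      by (simp add: card_Pow card_Diff_subset finite_subset)
    finally have "card (B p) * 2 ^ (k * k) \<le> 2 * 2 ^ (N * N - k * k) * 2 ^ (k * k)"
      by (rule mult_right_mono) simp
    also have "k * k \<le> N * N"
      using card_mono[OF fS sub[OF p(2,3)]] cRC[OF p(2,3)] cS by simp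
    then have "(2::nat) * 2 ^ (N * N - k * k) * 2 ^ (k * k) = 2 * 2 ^ (N * N)"
      by (simp add: mult.assoc flip: power_add)
    finally show ?thesis .
  qed
  have "card (\<Union>p\<in>\<K> \<times> \<K>. B p) * 2 ^ (k * k) \<le> (\<Sum>p\<in>\<K> \<times> \<K>. card (B p)) * 2 ^ (k * k)"
    by (intro mult_right_mono card_UN_le finite_cartesian_product f\<K>) simp
  also have "\<dots> \<le> card (\<K> \<times> \<K>) * (2 * 2 ^ (N * N))"
    unfolding sum_distrib_right using sum_bounded_above[of "\<K> \<times> \<K>", OF cB] by simp
  also have "\<dots> \<le> N ^ (2 * k) * (2 * 2 ^ (N * N))"
    using mult_mono[OF c\<K> c\<K>]
    by (intro mult_right_mono) (auto simp: card_cartesian_product mult_2 power_add)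
  also have "\<dots> < 2 ^ (N * N) * 2 ^ (k * k)"
    using assms by simp
  finally have less: "card (\<Union>p\<in>\<K> \<times> \<K>. B p) < card (Pow S)"
    by (simp add: card_Pow fS cS)
  have "\<not> Pow S \<subseteq> (\<Union>p\<in>\<K> \<times> \<K>. B p)"
  proof
    assume "Pow S \<subseteq> (\<Union>p\<in>\<K> \<times> \<K>. B p)"
    moreover have "finite (\<Union>p\<in>\<K> \<times> \<K>. B p)"
    proof (rule finite_subset)
      show "(\<Union>p\<in>\<K> \<times> \<K>. B p) \<subseteq> Pow S" unfolding B_def by blast
    qed (simp add: fS)
    ultimately show False using less by (meson card_mono leD)
  qed
  then obtain E where E: "E \<subseteq> S" "\<And>R C. R \<in> \<K> \<Longrightarrow> C \<in> \<K> \<Longrightarrow> E \<notin> B (R, C)"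
    by blast
  have "no_homogeneous N k E"
    unfolding no_homogeneous_def
  proof (intro allI impI)
    fix R C assume RC: "R \<subseteq> {..<N}" "C \<subseteq> {..<N}" "k \<le> card R" "k \<le> card C"
    \<comment> \<open>The count covers sets of size exactly \<open>k\<close>, so larger ones are
      shrunk first.\<close>
    obtain R' C' where R': "R' \<subseteq> R" "card R' = k" and C': "C' \<subseteq> C" "card C' = k"
      using RC(3,4) by (metis obtain_subset_with_card_n)
    then have "R' \<in> \<K>" "C' \<in> \<K>" using RC by (auto simp: \<K>_def)
    then have "E \<notin> B (R', C')" by (rule E(2))
    then have "\<not> R' \<times> C' \<subseteq> E \<and> R' \<times> C' \<inter> E \<noteq> {}"
      using E(1) by (auto simp: B_def)
    then show "\<not> R \<times> C \<subseteq> E \<and> R \<times> C \<inter> E \<noteq> {}" using R'(1) C'(1) by blast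
  qed
  then show ?thesis ..
qed

text \<open>Sort \<open>A\<close> by \<open>r\<close> and take the first \<open>k\<close> and the
  next \<open>k\<close> elements; injectivity makes the separation strict. This turns a condition on
  ordered pairs of indices into one on a full rectangle.\<close>

lemma ex_separated_halves:
  fixes r :: "'a \<Rightarrow> 'b::linorder"
  assumes "finite A" "inj_on r A" "2 * k \<le> card A"
  shows "\<exists>I J. I \<subseteq> A \<and> J \<subseteq> A \<and> card I = k \<and> card J = k \<and> (\<forall>i\<in>I. \<forall>j\<in>J. r i < r j)"
proof -
  define xs where "xs = sorted_list_of_set (r ` A)"
  have len: "2 * k \<le> length xs"
    using assms by (simp add: xs_def card_image)
  have set: "set xs = r ` A" and dist: "distinct xs" and sorted: "sorted_wrt (<) xs"
    using assms(1) by (simp_all add: xs_def)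
  have sub: "(!) xs ` {..<k} \<subseteq> r ` A" "(!) xs ` {k..<2 * k} \<subseteq> r ` A"
    using len by (auto simp flip: set)
  have card: "card ((!) xs ` {..<k}) = k" "card ((!) xs ` {k..<2 * k}) = k"
    using len by (auto simp: card_image inj_on_nth[OF dist])
  obtain I where I: "I \<subseteq> A" "inj_on r I" "(!) xs ` {..<k} = r ` I"
    using sub(1) by (auto simp: subset_image_inj)
  obtain J where J: "J \<subseteq> A" "inj_on r J" "(!) xs ` {k..<2 * k} = r ` J"
    using sub(2) by (auto simp: subset_image_inj)
  have "r i < r j" if "i \<in> I" "j \<in> J" for i j
  proof -
    have "r i \<in> (!) xs ` {..<k}" "r j \<in> (!) xs ` {k..<2 * k}"
      unfolding I(3) J(3) using that by auto
    then obtain a b where "r i = xs ! a" "a < k" "r j = xs ! b" "k \<le> b" "b < 2 * k"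
      by auto
    then show ?thesis using len sorted_wrt_nth_less[OF sorted, of a b] by simp
  qed
  moreover have "card I = k" "card J = k"
    using I J card by (metis card_image)+
  ultimately show ?thesis using I(1) J(1) by blast
qed

section \<open>The unitriangular class and its eluder dimension\<close>

text \<open>Row \<open>i\<close> of the sign matrix: 1 left of the diagonal, -1 on it, and to its
  right -1 exactly at the ones of \<open>E\<close>.\<close>

definition tri_fun :: "nat \<Rightarrow> (nat \<times> nat) set \<Rightarrow> nat \<Rightarrow> nat \<Rightarrow> int" where
  "tri_fun N E i = (\<lambda>j\<in>{..<N}. if i = j \<or> i < j \<and> (i, j) \<in> E then -1 else 1)"

definition tri_class :: "nat \<Rightarrow> (nat \<times> nat) set \<Rightarrow> (nat \<Rightarrow> int) set" where
  "tri_class N E = insert (\<lambda>j\<in>{..<N}. 1) (tri_fun N E ` {..<N})"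

lemma tri_class_subset: "tri_class N E \<subseteq> sign_functions {..<N}"
  by (auto simp: tri_class_def tri_fun_def sign_functions_def split: if_splits)

lemma tri_class_values:
  "f \<in> tri_class N E \<Longrightarrow> x < N \<Longrightarrow> f x = 1 \<or> f x = -1"
  using tri_class_subset[of N E] by (auto simp: sign_functions_def PiE_iff)

lemma tri_class_minusD:
  "f \<in> tri_class N E \<Longrightarrow> x < N \<Longrightarrow> f x = -1 \<Longrightarrow> f \<in> tri_fun N E ` {..<N}"
  by (auto simp: tri_class_def)

text \<open>The points are distinct, since \<open>f i\<close> agrees with \<open>g\<close> at every
  earlier point but not at \<open>x i\<close>.\<close>

lemma eluder_witness_le_card:
  assumes "finite X" "eluder_witness X F g m x f"
  shows "m \<le> card X"
proof -
  have "x i \<noteq> x j" if "i \<in> {1..m}" "j \<in> {1..m}" "j < i" for i j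
    using assms(2) that unfolding eluder_witness_def by metis
  then have "inj_on x {1..m}"
    by (metis inj_onI linorder_neqE_nat)
  moreover have "x ` {1..m} \<subseteq> X"
    using assms(2) by (auto simp: eluder_witness_def)
  ultimately show ?thesis
    using card_inj_on_le[OF _ _ assms(1)] by fastforce
qed

lemma Edim_tri_class: "Edim {..<N} (tri_class N E) = enat N"
proof (rule antisym)
  show "Edim {..<N} (tri_class N E) \<le> enat N"
    unfolding Edim_def Edim_at_def
    by (intro SUP_least) (auto dest: eluder_witness_le_card[rotated])
  let ?g = "\<lambda>j\<in>{..<N}. 1 :: int"
  \<comment> \<open>Witness indices start at 1 and rows at 0, hence the shift
    \<open>i - 1\<close>.\<close>
  have "eluder_witness {..<N} (tri_class N E) ?g N (\<lambda>i. i - 1) (\<lambda>i. tri_fun N E (i - 1))"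
    by (auto simp: eluder_witness_def tri_class_def tri_fun_def)
  then have "enat N \<le> Edim_at {..<N} (tri_class N E) ?g"
    unfolding Edim_at_def by (intro SUP_upper) blast
  also have "\<dots> \<le> Edim {..<N} (tri_class N E)"
    unfolding Edim_def by (intro SUP_upper) (simp add: tri_class_def del: restrict_apply)
  finally show "enat N \<le> Edim {..<N} (tri_class N E)" .
qed

section \<open>Bounds on the star number and the threshold dimension\<close>

text \<open>An entry -1 in row \<open>r\<close> and column \<open>c\<close> forces
  \<open>r \<le> c\<close>. Two indices common to \<open>R\<close> and \<open>C\<close> would thus
  bound each other and coincide, so removing \<open>R\<close> from \<open>C\<close> costs at most
  one column and leaves a rectangle inside \<open>E\<close>. This is why the sizes must exceed
  \<open>k\<close>.\<close>

lemma no_minus_rectangle: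
  assumes hom: "no_homogeneous N k E"
    and fin: "finite I" "finite J" and card: "k < card I" "k < card J"
    and inj: "inj_on f I" "inj_on x J"
    and cl: "\<And>i. i \<in> I \<Longrightarrow> f i \<in> tri_class N E" "\<And>j. j \<in> J \<Longrightarrow> x j < N"
    and minus: "\<And>i j. i \<in> I \<Longrightarrow> j \<in> J \<Longrightarrow> f i (x j) = -1"
  shows False
proof -
  define C where "C = x ` J"
  have "J \<noteq> {}" using card(2) by auto
  then have "f ` I \<subseteq> tri_fun N E ` {..<N}"
    using tri_class_minusD[OF cl(1) cl(2) minus] by blast
  then obtain R where R: "R \<subseteq> {..<N}" "inj_on (tri_fun N E) R" "f ` I = tri_fun N E ` R"
    by (auto simp: subset_image_inj)
  have C: "C \<subseteq> {..<N}" "card C = card J" "finite C"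
    using cl(2) inj(2) fin(2) by (auto simp: C_def card_image)
  have cR: "card R = card I"
    using R inj(1) by (metis card_image)
  have "r = c \<or> r < c \<and> (r, c) \<in> E" if rc: "r \<in> R" "c \<in> C" for r c
  proof -
    have "tri_fun N E r c = -1"
      using R(3) rc minus by (force simp: C_def)
    then show ?thesis
      using C(1) rc(2) by (auto simp: tri_fun_def split: if_splits)
  qed
  note entry = this
  have "r = s" if "r \<in> R \<inter> C" "s \<in> R \<inter> C" for r s
    using entry[of r s] entry[of s r] that by auto
  then have "card (R \<inter> C) \<le> 1"
    using C(3) by (simp add: card_le_Suc0_iff_eq)
  then have "k \<le> card (C - R)"
    using C card(2) by (simp add: card_Diff_subset_Int Int_commute)
  moreover have "R \<times> (C - R) \<subseteq> E"
    using entry by auto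
  ultimately show False
    using hom[unfolded no_homogeneous_def, rule_format, of R "C - R"] R(1) C(1) cR card(1) by auto
qed

text \<open>Pigeonhole on the sign of \<open>g\<close>. The \<open>2 * (k + 1)\<close> surviving
  indices are later split into two halves of size \<open>k + 1\<close>, as
  \<open>no_minus_rectangle\<close> requires.\<close>

lemma ex_half_constant:
  assumes "\<And>i. i \<in> {1..m} \<Longrightarrow> g (x i) = 1 \<or> g (x i) = (-1::int)" "4 * k + 4 \<le> m"
  shows "\<exists>A v. A \<subseteq> {1..m} \<and> 2 * (k + 1) \<le> card A \<and> (\<forall>i\<in>A. g (x i) = v) \<and> (v = 1 \<or> v = -1)"
proof -
  define P where "P v = {i\<in>{1..m}. g (x i) = v}" for v
  have "{1..m} = P 1 \<union> P (-1)"
    using assms(1) unfolding P_def by blast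
  then have "m \<le> card (P 1) + card (P (-1))"
    using card_Un_le[of "P 1" "P (-1)"] by (metis card_atLeastAtMost diff_Suc_1)
  then have "2 * (k + 1) \<le> card (P 1) \<or> 2 * (k + 1) \<le> card (P (-1))"
    using assms(2) by arith
  moreover have "P v \<subseteq> {1..m}" "\<forall>i\<in>P v. g (x i) = v" for v
    by (auto simp: P_def)
  ultimately show ?thesis by blast
qed

text \<open>Where \<open>g\<close> is -1, the off-diagonal agreements form a rectangle of -1. Where
  \<open>g\<close> is 1, they form a rectangle of 1, which says something about \<open>E\<close>
  only above the diagonal.\<close>

lemma star_witness_bound:
  assumes hom: "no_homogeneous N k E" and g: "g \<in> tri_class N E"
    and wit: "star_witness {..<N} (tri_class N E) g m x f"
  shows "m \<le> 4 * k + 3"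
proof (rule ccontr)
  assume "\<not> m \<le> 4 * k + 3"
  then have m: "4 * k + 4 \<le> m" by simp
  have w: "x i < N" "f i \<in> tri_class N E" "f i (x i) \<noteq> g (x i)" if "i \<in> {1..m}" for i
    using wit that by (auto simp: star_witness_def)
  have off: "f i (x j) = g (x j)" if "i \<in> {1..m}" "j \<in> {1..m}" "i \<noteq> j" for i j
    using wit that by (auto simp: star_witness_def)
  obtain A v where A: "A \<subseteq> {1..m}" "2 * (k + 1) \<le> card A" "\<And>i. i \<in> A \<Longrightarrow> g (x i) = v"
    and v: "v = 1 \<or> v = -1"
    using ex_half_constant[of m g x, OF tri_class_values[OF g w(1)] m] by blast
  have fin: "finite A" using A(1) finite_subset by blast
  have "inj_on x {1..m}" by (metis inj_onI off w(3))
  then have injx: "inj_on x B" if "B \<subseteq> A" for B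
    using that A(1) inj_on_subset by blast
  have "inj_on f {1..m}" by (metis inj_onI off w(3))
  then have injf: "inj_on f B" if "B \<subseteq> A" for B
    using that A(1) inj_on_subset by blast
  show False
  proof (cases "v = 1")
    case True
    have "\<forall>i\<in>A. \<exists>r. r < N \<and> f i = tri_fun N E r"
    proof
      fix i assume i: "i \<in> A"
      then have "f i (x i) = -1"
        using tri_class_values[OF w(2) w(1), of i i] w(3)[of i] A(1,3) True by force
      then show "\<exists>r. r < N \<and> f i = tri_fun N E r"
        using tri_class_minusD[OF w(2) w(1), of i i] subsetD[OF A(1) i] by blast
    qed
    then obtain r where r: "\<And>i. i \<in> A \<Longrightarrow> r i < N" "\<And>i. i \<in> A \<Longrightarrow> f i = tri_fun N E (r i)"
      by metis
    \<comment> \<open>Here \<open>f i (x i) = -1\<close>, and a row has no -1 left of the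
      diagonal.\<close>
    have r_le: "r i \<le> x i" if "i \<in> A" for i
      using w(1,3)[of i] that A(1) r(2)[of i] A(3)[of i] True
      by (force simp: tri_fun_def split: if_splits)
    have injr: "inj_on r A"
      using injf[OF subset_refl] r(2) by (metis inj_on_def)
    \<comment> \<open>Splitting by row index puts the rectangle above the diagonal: \<open>r i < r j \<le> x j\<close>.\<close>
    obtain I J where IJ: "I \<subseteq> A" "J \<subseteq> A" "card I = k + 1" "card J = k + 1"
      "\<And>i j. i \<in> I \<Longrightarrow> j \<in> J \<Longrightarrow> r i < r j"
      using ex_separated_halves[OF fin injr A(2)] by blast
    have "r ` I \<times> x ` J \<inter> E = {}"
    proof -
      have "(r i, x j) \<notin> E" if ij: "i \<in> I" "j \<in> J" for i j
      proof -
        have "i \<noteq> j" using IJ(5)[OF ij] by auto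
        then have "tri_fun N E (r i) (x j) = 1"
          using off[of i j] r(2)[of i] A(1,3) IJ(1,2) ij True by (metis subsetD)
        moreover have "r i < x j" using IJ(5)[OF ij] r_le[of j] IJ(2) ij by force
        moreover have "x j < N" using w(1) A(1) IJ(2) ij by blast
        ultimately show ?thesis by (auto simp: tri_fun_def split: if_splits)
      qed
      then show ?thesis by auto
    qed
    moreover have "card (r ` I) = k + 1" "card (x ` J) = k + 1"
      using IJ(1-4) injr injx by (simp_all add: card_image inj_on_subset)
    moreover have "r ` I \<subseteq> {..<N}" "x ` J \<subseteq> {..<N}"
      using r(1) w(1) A(1) IJ(1,2) by auto
    ultimately show False
      using hom[unfolded no_homogeneous_def, rule_format, of "r ` I" "x ` J"] by simp
  next
    case False
    \<comment> \<open>The star condition is symmetric in the indices; the order makes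
      \<open>I\<close> and \<open>J\<close> disjoint.\<close>
    obtain I J where IJ: "I \<subseteq> A" "J \<subseteq> A" "card I = k + 1" "card J = k + 1"
      "\<And>i j. i \<in> I \<Longrightarrow> j \<in> J \<Longrightarrow> i < j"
      using ex_separated_halves[OF fin inj_on_id2 A(2)] by blast
    show False
    proof (rule no_minus_rectangle[OF hom, of I J f x])
      show "f i (x j) = -1" if "i \<in> I" "j \<in> J" for i j
        using off[of i j] A(1,3) IJ(1,2) IJ(5)[OF that] that False v by force
    qed (use IJ A(1) w injx injf finite_subset[OF _ fin] in auto)
  qed
qed

text \<open>For \<open>i < j\<close>, \<open>f i\<close> disagrees with \<open>g\<close> at
  \<open>x j\<close>, while \<open>f j\<close> agrees with it at \<open>x i\<close>. Whichever sign
  \<open>g\<close> has, one of these two gives a rectangle of -1.\<close>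

lemma threshold_witness_bound:
  assumes hom: "no_homogeneous N k E" and g: "g \<in> tri_class N E"
    and wit: "threshold_witness {..<N} (tri_class N E) g m x f"
  shows "m \<le> 4 * k + 3"
proof (rule ccontr)
  assume "\<not> m \<le> 4 * k + 3"
  then have m: "4 * k + 4 \<le> m" by simp
  have w: "x i < N" "f i \<in> tri_class N E" if "i \<in> {1..m}" for i
    using wit that by (auto simp: threshold_witness_def)
  have ge: "f i (x j) \<noteq> g (x j)" if "i \<in> {1..m}" "j \<in> {1..m}" "i \<le> j" for i j
    using wit that by (auto simp: threshold_witness_def)
  have less: "f i (x j) = g (x j)" if "i \<in> {1..m}" "j \<in> {1..m}" "j < i" for i j
    using wit that by (auto simp: threshold_witness_def)
  obtain A v where A: "A \<subseteq> {1..m}" "2 * (k + 1) \<le> card A" "\<And>i. i \<in> A \<Longrightarrow> g (x i) = v"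
    and v: "v = 1 \<or> v = -1"
    using ex_half_constant[of m g x, OF tri_class_values[OF g w(1)] m] by blast
  have fin: "finite A" using A(1) finite_subset by blast
  have "inj_on x {1..m}"
    by (metis inj_onI ge less linorder_neqE_nat order_refl)
  then have injx: "inj_on x B" if "B \<subseteq> A" for B
    using that A(1) inj_on_subset by blast
  have "inj_on f {1..m}"
    by (metis inj_onI ge less linorder_neqE_nat order_refl)
  then have injf: "inj_on f B" if "B \<subseteq> A" for B
    using that A(1) inj_on_subset by blast
  obtain I J where IJ: "I \<subseteq> A" "J \<subseteq> A" "card I = k + 1" "card J = k + 1"
    "\<And>i j. i \<in> I \<Longrightarrow> j \<in> J \<Longrightarrow> i < j"
    using ex_separated_halves[OF fin inj_on_id2 A(2)] by blast
  show False
  proof (cases "v = 1")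
    case True
    show False
    proof (rule no_minus_rectangle[OF hom, of I J f x])
      show "f i (x j) = -1" if ij: "i \<in> I" "j \<in> J" for i j
      proof -
        have "i \<in> {1..m}" "j \<in> {1..m}" "j \<in> A" using ij IJ(1,2) A(1) by auto
        then show ?thesis
          using ge[of i j] A(3)[of j] IJ(5)[OF ij] tri_class_values[OF w(2) w(1), of i j] True
          by auto
      qed
    qed (use IJ A(1) w injx injf finite_subset[OF _ fin] in auto)
  next
    case False
    show False
    \<comment> \<open>The later indices now supply the functions and the earlier ones the
      points.\<close>
    proof (rule no_minus_rectangle[OF hom, of J I f x])
      show "f j (x i) = -1" if "j \<in> J" "i \<in> I" for i j
        using less[of j i] A(1,3) IJ(1,2) IJ(5)[OF that(2,1)] that False v by force
    qed (use IJ A(1) w injx injf finite_subset[OF _ fin] in auto)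
  qed
qed

lemma Sdim_Tdim_tri_class:
  assumes "no_homogeneous N k E"
  shows "max (Sdim {..<N} (tri_class N E)) (Tdim {..<N} (tri_class N E)) \<le> enat (4 * k + 3)"
  unfolding Sdim_def Tdim_def Sdim_at_def Tdim_at_def
  by (intro max.boundedI SUP_least)
    (auto dest: star_witness_bound[OF assms] threshold_witness_bound[OF assms])

section \<open>Choice of the parameters\<close>

theorem theorem9:
  "\<exists>c::real. c > 1 / 2 \<and>
     (\<forall>N::nat. N \<ge> 2 \<longrightarrow>
        (\<exists>(X::nat set) F. F \<subseteq> sign_functions X \<and>
           Edim X F = enat N \<and>
           ereal_of_enat (max (Sdim X F) (Tdim X F)) < ereal (c * log 2 (real N))))"
proof (intro exI[of _ 24] conjI allI impI)
  fix N :: nat assume N: "2 \<le> N"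
  obtain L where L: "2 ^ L \<le> N" "N < 2 ^ (L + 1)"
    using ex_power_ivl1[of 2 N] N by auto
  \<comment> \<open>With \<open>k = 2 * (L + 1) + 1\<close>, the square \<open>k * k\<close> exceeds
    \<open>(L + 1) * (2 * k)\<close> by \<open>k\<close>, which is at least 3; this absorbs the
    factor 2 of the union bound.\<close>
  define k where "k = 2 * L + 3"
  have "N ^ (2 * k) \<le> (2 ^ (L + 1)) ^ (2 * k)"
    using L(2) by (intro power_mono) auto
  also have "\<dots> = 2 ^ ((L + 1) * (2 * k))"
    by (simp only: power_mult)
  finally have "2 * N ^ (2 * k) \<le> 2 ^ (1 + (L + 1) * (2 * k))"
    by simp
  also have "\<dots> < 2 ^ (k * k)"
    by (rule power_strict_increasing) (auto simp: k_def algebra_simps)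
  finally obtain E where E: "no_homogeneous N k E"
    using ex_no_homogeneous by blast
  have "real L \<le> log 2 (real N)"
    using le_log2_of_power[OF L(1)] .
  moreover have "1 \<le> log 2 (real N)"
    using N by simp
  \<comment> \<open>\<open>4 * k + 3 = 8 * L + 15\<close> is at most \<open>23 * log 2 N\<close>,
    because both \<open>L\<close> and 1 are at most \<open>log 2 N\<close>; the constant 24 makes
    the inequality strict.\<close>
  ultimately have bound: "real (4 * k + 3) < 24 * log 2 (real N)"
    by (simp add: k_def)
  have "ereal_of_enat (max (Sdim {..<N} (tri_class N E)) (Tdim {..<N} (tri_class N E)))
      \<le> ereal_of_enat (enat (4 * k + 3))"
    using Sdim_Tdim_tri_class[OF E] by (simp only: ereal_of_enat_le_iff)
  also have "\<dots> < ereal (24 * log 2 (real N))"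
    using bound by simp
  finally show "\<exists>(X::nat set) F. F \<subseteq> sign_functions X \<and> Edim X F = enat N \<and>
      ereal_of_enat (max (Sdim X F) (Tdim X F)) < ereal (24 * log 2 (real N))"
    using tri_class_subset Edim_tri_class by blast
qed simp

end
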